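(* Let $G=(V,E)$ be a (simple, undirected) graph with $|V|=n$ and $|E|=m$, and set \[ q := \left\lfloor \frac{\ln (n/2)}{\ln (2 e n^2/m)}\right\rfloor, \qquad r := \left\lfloor \frac{q n^2}{m}\right\rfloor. \] If $n$ is sufficiently large and $m \ge 3 n^{3/2}$, then Algorithm FIND-BIPARTITE (described in the context, run with these values of $q$ and $r$) returns a complete bipartite subgraph $K_{q,q}$ of $G$, and $q \ge 2$ as long as $m > 8 n^{3/2}$. The running time of the algorithm is polynomial in $n$.
   Context: Algorithm FIND-BIPARTITE: the input is a graph $G=(V,E)$ with $|V|=n$, $|E|=m$ (given, e.g., by its adjacency matrix), together with integers $q$ and $r$. Let $R$ be a set of $r$ vertices of $G$ of highest degree (i.e., every vertex in $R$ has degree at least that of every vertex outside $R$). For every subset $C\subseteq R$ with $|C|=q$, compute $D := \bigcap_{v\in C} (N(v)\setminus R)$, where $N(v)$ is the set of neighbours of $v$ in $G$; if $|D|\ge q$, let $D'$ be the first $q$ elements of $D$ and return $(C,D')$ (the pair $(C,D')$ spans a complete bipartite subgraph $K_{q,q}$ with parts $C$ and $D'$, i.e., every vertex of $C$ is adjacent to every vertex of $D'$). A $K_{q,q}$ means a complete bipartite graph with both parts of size $q$. *)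

theory Defs
  imports Complex_Main "HOL-Library.Monad_Syntax" "HOL-Computational_Algebra.Polynomial"
begin

section \<open>Graphs\<close>

definition simple_graph :: "'a set \<Rightarrow> 'a set set \<Rightarrow> bool" where
  "simple_graph V E \<longleftrightarrow> finite V \<and> (\<forall>e\<in>E. e \<subseteq> V \<and> card e = 2)"

definition adjacent :: "'a set set \<Rightarrow> 'a \<Rightarrow> 'a \<Rightarrow> bool" where
  "adjacent E u v \<longleftrightarrow> {u, v} \<in> E"

definition complete_bipartite_in ::
  "'a set \<Rightarrow> 'a set set \<Rightarrow> nat \<Rightarrow> 'a set \<Rightarrow> 'a set \<Rightarrow> bool" where
  "complete_bipartite_in V E q C D \<longleftrightarrow>
     C \<subseteq> V \<and> D \<subseteq> V \<and> C \<inter> D = {} \<and> finite C \<and> finite D \<and> card C = q \<and> card D = q \<and>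
     (\<forall>c\<in>C. \<forall>d\<in>D. adjacent E c d)"

section \<open>Programs with a running time\<close>

text \<open>
  A timed value is the result of a program together with the number of steps taken. Every call of
  one of the functions below, recursive calls included, is charged one step. Apart from further
  such calls the body of each function performs a constant number of unit-cost operations of a
  random access machine: look up an entry of the adjacency matrix, compare two vertices, build or
  take apart a list cell or a pair, compare, increment or decrement a number. The number of steps
  is therefore the running time up to a constant factor.
\<close>

datatype 'a timed = Timed (val: 'a) (time: nat)

definition return_timed :: "'a \<Rightarrow> 'a timed" where
  "return_timed x = Timed x 0"

definition bind_timed :: "'a timed \<Rightarrow> ('a \<Rightarrow> 'b timed) \<Rightarrow> 'b timed" where
  "bind_timed s f = Timed (val (f (val s))) (time s + time (f (val s)))"

definition tick :: "'a timed \<Rightarrow> 'a timed" where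
  "tick s = Timed (val s) (time s + 1)"

adhoc_overloading Monad_Syntax.bind \<rightleftharpoons> bind_timed

lemma val_time_simps [simp]:
  "val (return_timed x) = x" "time (return_timed x) = 0"
  "val (bind_timed s f) = val (f (val s))" "time (bind_timed s f) = time s + time (f (val s))"
  "val (tick s) = val s" "time (tick s) = time s + 1"
  by (simp_all add: return_timed_def bind_timed_def tick_def)

section \<open>The algorithm\<close>

fun member_t :: "'a \<Rightarrow> 'a list \<Rightarrow> bool timed" where
  "member_t x [] = tick (return_timed False)"
| "member_t x (y # ys) = tick (if x = y then return_timed True else member_t x ys)"

fun length_t :: "'a list \<Rightarrow> nat timed" where
  "length_t [] = tick (return_timed 0)"
| "length_t (x # xs) = tick (do { l \<leftarrow> length_t xs; return_timed (Suc l) })"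

fun take_t :: "nat \<Rightarrow> 'a list \<Rightarrow> 'a list timed" where
  "take_t 0 xs = tick (return_timed [])"
| "take_t (Suc k) [] = tick (return_timed [])"
| "take_t (Suc k) (x # xs) = tick (do { ys \<leftarrow> take_t k xs; return_timed (x # ys) })"

fun append_t :: "'a list \<Rightarrow> 'a list \<Rightarrow> 'a list timed" where
  "append_t [] ys = tick (return_timed ys)"
| "append_t (x # xs) ys = tick (do { zs \<leftarrow> append_t xs ys; return_timed (x # zs) })"

fun degree_t :: "('a \<Rightarrow> 'a \<Rightarrow> bool) \<Rightarrow> 'a \<Rightarrow> 'a list \<Rightarrow> nat timed" where
  "degree_t adj v [] = tick (return_timed 0)"
| "degree_t adj v (u # us) =
     tick (do { d \<leftarrow> degree_t adj v us; return_timed (if adj v u then Suc d else d) })"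

fun degrees_t :: "('a \<Rightarrow> 'a \<Rightarrow> bool) \<Rightarrow> 'a list \<Rightarrow> 'a list \<Rightarrow> (nat \<times> 'a) list timed" where
  "degrees_t adj vs [] = tick (return_timed [])"
| "degrees_t adj vs (u # us) =
     tick (do { d \<leftarrow> degree_t adj u vs; ds \<leftarrow> degrees_t adj vs us; return_timed ((d, u) # ds) })"

text \<open>Stable insertion sort by decreasing first component.\<close>

fun insert_t :: "nat \<times> 'a \<Rightarrow> (nat \<times> 'a) list \<Rightarrow> (nat \<times> 'a) list timed" where
  "insert_t x [] = tick (return_timed [x])"
| "insert_t x (y # ys) =
     tick (if fst y \<le> fst x then return_timed (x # y # ys)
           else do { zs \<leftarrow> insert_t x ys; return_timed (y # zs) })"

fun sort_t :: "(nat \<times> 'a) list \<Rightarrow> (nat \<times> 'a) list timed" where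
  "sort_t [] = tick (return_timed [])"
| "sort_t (x # xs) = tick (do { ys \<leftarrow> sort_t xs; insert_t x ys })"

fun vertices_t :: "(nat \<times> 'a) list \<Rightarrow> 'a list timed" where
  "vertices_t [] = tick (return_timed [])"
| "vertices_t (x # xs) = tick (do { ys \<leftarrow> vertices_t xs; return_timed (snd x # ys) })"

definition highest_degree_t :: "('a \<Rightarrow> 'a \<Rightarrow> bool) \<Rightarrow> 'a list \<Rightarrow> nat \<Rightarrow> 'a list timed" where
  "highest_degree_t adj vs r =
     tick (do { ds \<leftarrow> degrees_t adj vs vs; ss \<leftarrow> sort_t ds; ts \<leftarrow> take_t r ss; vertices_t ts })"

fun remove_t :: "'a list \<Rightarrow> 'a list \<Rightarrow> 'a list timed" where
  "remove_t R [] = tick (return_timed [])"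
| "remove_t R (v # vs) =
     tick (do { b \<leftarrow> member_t v R; ws \<leftarrow> remove_t R vs; return_timed (if b then ws else v # ws) })"

fun cons_all_t :: "'a \<Rightarrow> 'a list list \<Rightarrow> 'a list list timed" where
  "cons_all_t x [] = tick (return_timed [])"
| "cons_all_t x (C # Cs) = tick (do { Ds \<leftarrow> cons_all_t x Cs; return_timed ((x # C) # Ds) })"

fun subsets_t :: "nat \<Rightarrow> 'a list \<Rightarrow> 'a list list timed" where
  "subsets_t 0 xs = tick (return_timed [[]])"
| "subsets_t (Suc k) [] = tick (return_timed [])"
| "subsets_t (Suc k) (x # xs) =
     tick (do { As \<leftarrow> subsets_t k xs; Bs \<leftarrow> subsets_t (Suc k) xs;
                As' \<leftarrow> cons_all_t x As; append_t As' Bs })"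

fun neighbours_t :: "('a \<Rightarrow> 'a \<Rightarrow> bool) \<Rightarrow> 'a \<Rightarrow> 'a list \<Rightarrow> 'a list timed" where
  "neighbours_t adj v [] = tick (return_timed [])"
| "neighbours_t adj v (w # ws) =
     tick (do { us \<leftarrow> neighbours_t adj v ws; return_timed (if adj v w then w # us else us) })"

text \<open>
  With \<open>W\<close> listing the vertices outside \<open>R\<close>, this intersects the sets \<open>N(v) - R\<close>
  over all \<open>v\<close> in \<open>C\<close>.
\<close>

fun common_t :: "('a \<Rightarrow> 'a \<Rightarrow> bool) \<Rightarrow> 'a list \<Rightarrow> 'a list \<Rightarrow> 'a list timed" where
  "common_t adj [] W = tick (return_timed W)"
| "common_t adj (v # C) W = tick (do { W' \<leftarrow> neighbours_t adj v W; common_t adj C W' })"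

fun search_t ::
  "('a \<Rightarrow> 'a \<Rightarrow> bool) \<Rightarrow> nat \<Rightarrow> 'a list \<Rightarrow> 'a list list \<Rightarrow> ('a list \<times> 'a list) option timed" where
  "search_t adj q W [] = tick (return_timed None)"
| "search_t adj q W (C # Cs) =
     tick (do { D \<leftarrow> common_t adj C W; l \<leftarrow> length_t D;
                if q \<le> l then do { D' \<leftarrow> take_t q D; return_timed (Some (C, D')) }
                else search_t adj q W Cs })"

text \<open>
  The list \<open>vs\<close> enumerates the vertices and \<open>adj\<close> is the adjacency matrix. The order of \<open>vs\<close>
  decides ties between vertices of equal degree and which elements of \<open>D\<close> come first; every set
  of \<open>r\<close> vertices of highest degree is selected for some order of \<open>vs\<close>.
\<close>

definition find_bipartite ::
  "('a \<Rightarrow> 'a \<Rightarrow> bool) \<Rightarrow> 'a list \<Rightarrow> nat \<Rightarrow> nat \<Rightarrow> ('a list \<times> 'a list) option timed" where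
  "find_bipartite adj vs q r =
     tick (do { R \<leftarrow> highest_degree_t adj vs r; W \<leftarrow> remove_t R vs;
                Cs \<leftarrow> subsets_t q R; search_t adj q W Cs })"

section \<open>What the algorithm computes\<close>

lemma val_basic [simp]:
  "val (member_t x xs) \<longleftrightarrow> x \<in> set xs"
  "val (length_t xs) = length xs"
  "val (append_t xs ys) = xs @ ys"
  "val (vertices_t ps) = map snd ps"
  "val (cons_all_t x Cs) = map ((#) x) Cs"
proof -
  show "val (member_t x xs) \<longleftrightarrow> x \<in> set xs" by (induction xs) auto
  show "val (length_t xs) = length xs" by (induction xs) auto
  show "val (append_t xs ys) = xs @ ys" by (induction xs) auto
  show "val (vertices_t ps) = map snd ps" by (induction ps) auto
  show "val (cons_all_t x Cs) = map ((#) x) Cs" by (induction Cs) auto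
qed

lemma val_take_t [simp]: "val (take_t k xs) = take k xs"
  by (induction k xs rule: take_t.induct) auto

lemma val_degree_t [simp]: "val (degree_t adj v us) = length (filter (adj v) us)"
  by (induction us) auto

lemma val_degrees_t [simp]:
  "val (degrees_t adj vs us) = map (\<lambda>u. (length (filter (adj u) vs), u)) us"
  by (induction us) auto

lemma val_sort_t [simp]: "val (sort_t ps) = sort_key (\<lambda>p. - int (fst p)) ps"
proof -
  have "val (insert_t p qs) = insort_key (\<lambda>p. - int (fst p)) p qs" for p and qs :: "(nat \<times> 'a) list"
    by (induction qs) auto
  then show ?thesis
    by (induction ps) auto
qed

lemma val_remove_t [simp]: "val (remove_t R vs) = filter (\<lambda>v. v \<notin> set R) vs"
  by (induction vs) auto

lemma val_common_t [simp]: "val (common_t adj C W) = filter (\<lambda>w. \<forall>v\<in>set C. adj v w) W"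
proof -
  have "val (neighbours_t adj v ws) = filter (adj v) ws" for v ws
    by (induction ws) auto
  then show ?thesis
    by (induction C arbitrary: W) (auto intro: filter_cong)
qed

lemma highest_degree_t_correct:
  fixes adj :: "'a \<Rightarrow> 'a \<Rightarrow> bool"
  assumes "distinct vs" "r \<le> length vs"
  defines "R \<equiv> val (highest_degree_t adj vs r)"
  shows "distinct R" "length R = r" "set R \<subseteq> set vs"
    "\<And>u v. u \<in> set R \<Longrightarrow> v \<in> set vs - set R \<Longrightarrow>
       card {w \<in> set vs. adj v w} \<le> card {w \<in> set vs. adj u w}"
proof -
  define ps where "ps = map (\<lambda>u. (length (filter (adj u) vs), u)) vs"
  define ss where "ss = sort_key (\<lambda>p. - int (fst p)) ps"
  have R: "R = take r (map snd ss)"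
    by (simp add: R_def highest_degree_t_def ss_def ps_def take_map)
  have "mset (map snd ss) = mset (map snd ps)"
    by (simp add: ss_def)
  moreover have "map snd ps = vs"
    by (simp add: ps_def o_def)
  ultimately have ms: "mset (map snd ss) = mset vs"
    by simp
  have dist: "distinct (map snd ss)" and set: "set (map snd ss) = set vs"
    and len: "length ss = length vs"
    using ms assms(1) mset_eq_imp_distinct_iff mset_eq_setD mset_eq_length by (blast, blast, fastforce)
  show "distinct R" "length R = r" "set R \<subseteq> set vs"
    using dist len assms(2) set set_take_subset[of r "map snd ss"] by (auto simp: R simp del: set_map)
  fix u v assume u: "u \<in> set R" and v: "v \<in> set vs - set R"
  have deg: "fst p = card {w \<in> set vs. adj (snd p) w}" if "p \<in> set ss" for p
    using that assms(1) by (auto simp: ss_def ps_def distinct_length_filter Int_def conj_commute)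
  obtain i where i: "i < r" "i < length ss" "u = snd (ss ! i)"
    using u by (auto simp: R in_set_conv_nth)
  obtain j where j: "j < length ss" "v = snd (ss ! j)"
    using v set by (metis DiffD1 in_set_conv_nth length_map nth_map)
  have "\<not> j < r"
    using v j by (auto simp: R in_set_conv_nth)
  then have "- int (fst (ss ! i)) \<le> - int (fst (ss ! j))"
    using sorted_nth_mono[OF sorted_sort_key[of "\<lambda>p. - int (fst p)" ps], of i j] i j
    by (simp add: ss_def)
  then show "card {w \<in> set vs. adj v w} \<le> card {w \<in> set vs. adj u w}"
    using deg i j by simp
qed

lemma subsets_t_correct:
  assumes "distinct xs"
  shows "set ` set (val (subsets_t k xs)) = {C. C \<subseteq> set xs \<and> card C = k}"
  using assms
proof (induction k xs rule: subsets_t.induct)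
  case (1 xs)
  then show ?case by (auto dest: finite_subset[OF _ finite_set])
next
  case (2 k)
  then show ?case by auto
next
  case (3 k x xs)
  have "{C. C \<subseteq> set (x # xs) \<and> card C = Suc k} =
      insert x ` {C. C \<subseteq> set xs \<and> card C = k} \<union> {C. C \<subseteq> set xs \<and> card C = Suc k}" (is "?L = ?M \<union> ?N")
  proof (intro equalityI subsetI)
    fix C assume C: "C \<in> ?L"
    then have fin: "finite C" using finite_subset by fastforce
    show "C \<in> ?M \<union> ?N"
    proof (cases "x \<in> C")
      case True
      then have "C = insert x (C - {x})" "C - {x} \<subseteq> set xs" "card (C - {x}) = k"
        using C fin by auto
      then show ?thesis by blast
    qed (use C in auto)
  next
    have "card (insert x B) = Suc (card B)" if "B \<subseteq> set xs" for B
      using that 3(3) finite_subset[OF that finite_set] by (subst card_insert_disjoint) auto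
    moreover fix C assume "C \<in> ?M \<union> ?N"
    ultimately show "C \<in> ?L"
      by auto
  qed
  moreover have "set ` set (val (subsets_t (Suc k) (x # xs))) =
      insert x ` set ` set (val (subsets_t k xs)) \<union> set ` set (val (subsets_t (Suc k) xs))"
    by (simp add: image_Un image_image)
  ultimately show ?case using 3 by simp
qed

lemma search_t_correct:
  "val (search_t adj q W Cs) =
     map_option (\<lambda>C. (C, take q (filter (\<lambda>w. \<forall>v\<in>set C. adj v w) W)))
       (find (\<lambda>C. q \<le> length (filter (\<lambda>w. \<forall>v\<in>set C. adj v w) W)) Cs)"
  by (induction Cs) auto

section \<open>Parameters\<close>

text \<open>
  For a graph with at least one edge both rounded quotients are nonnegative, so that \<open>nat\<close>
  loses nothing.
\<close>

definition fb_q :: "nat \<Rightarrow> nat \<Rightarrow> nat" where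
  "fb_q n m = nat \<lfloor>ln (real n / 2) / ln (2 * exp 1 * (real n)\<^sup>2 / real m)\<rfloor>"

definition fb_r :: "nat \<Rightarrow> nat \<Rightarrow> nat" where
  "fb_r n m = nat \<lfloor>real (fb_q n m) * (real n)\<^sup>2 / real m\<rfloor>"

end

theory Submission
  imports Defs
begin

text \<open>
  Put \<open>x = n\<^sup>2 / m\<close>, so that \<open>(2 e x)\<^sup>q \<le> n / 2\<close> and \<open>r\<close> is about \<open>q x\<close>. The \<open>r\<close> vertices of
  highest degree have degree sum at least \<open>2 m r / n\<close>, of which at most \<open>r\<^sup>2\<close> is spent inside \<open>R\<close>.
  If every \<open>q\<close>-subset of \<open>R\<close> has fewer than \<open>q\<close> common neighbours outside \<open>R\<close>, then, \<open>d(w)\<close> being the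
  number of neighbours in \<open>R\<close> of a vertex \<open>w\<close> outside \<open>R\<close>, double counting gives
  \<open>\<Sum>w. (d(w) choose q) \<le> (q - 1) (r choose q)\<close>. No convexity is needed: the linear bound
  \<open>d - (q - 1) \<le> (d choose q)\<close> already yields
  \<open>2 m r / n \<le> r\<^sup>2 + (q - 1) n + (q - 1) (r choose q)\<close>. Here the left side is at least
  \<open>(2 q - 1) n\<close>, while \<open>r\<^sup>2 \<le> q n / 2\<close> and \<open>(r choose q) \<le> (e r / q)\<^sup>q \<le> n / 2\<^sup>q\<^sup>+\<^sup>1\<close>, a contradiction.

  The estimate \<open>(e r / q)\<^sup>q\<close> bounds even the number of subsets of \<open>R\<close> of size at most \<open>q\<close>, which
  governs the running time.
\<close>

section \<open>Counting\<close>

lemma sum_card_swap: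
  assumes "finite A" "finite B"
  shows "(\<Sum>x\<in>A. card {y\<in>B. P x y}) = (\<Sum>y\<in>B. card {x\<in>A. P x y})"
proof -
  have "(\<Sum>x\<in>A. card {y\<in>B. P x y}) = (\<Sum>x\<in>A. \<Sum>y\<in>B. of_bool (P x y))"
    using assms by (simp add: Int_def)
  also have "\<dots> = (\<Sum>y\<in>B. \<Sum>x\<in>A. of_bool (P x y))"
    by (rule sum.swap)
  also have "\<dots> = (\<Sum>y\<in>B. card {x\<in>A. P x y})"
    using assms by (simp add: Int_def)
  finally show ?thesis .
qed

text \<open>Each edge at \<open>v\<close> is \<open>{v, w}\<close> for exactly one neighbour
  \<open>w\<close>, so the degrees count incidences of vertices with edges, and every edge has two
  endpoints.\<close>

lemma sum_degrees:
  assumes "simple_graph V E"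
  shows "(\<Sum>v\<in>V. card {w\<in>V. adjacent E v w}) = 2 * card E"
proof -
  have E: "e \<subseteq> V" "card e = 2" if "e \<in> E" for e
    using assms that by (auto simp: simple_graph_def)
  have finV: "finite V"
    using assms by (simp add: simple_graph_def)
  have "E \<subseteq> Pow V"
    using E by auto
  then have finE: "finite E"
    using finV finite_subset by auto
  have "card {w\<in>V. adjacent E v w} = card {e\<in>E. v \<in> e}" if "v \<in> V" for v
  proof (rule bij_betw_same_card[of "\<lambda>w. {v, w}"], rule bij_betw_imageI)
    show "inj_on (\<lambda>w. {v, w}) {w \<in> V. adjacent E v w}"
      by (auto simp: inj_on_def doubleton_eq_iff)
    show "(\<lambda>w. {v, w}) ` {w \<in> V. adjacent E v w} = {e \<in> E. v \<in> e}"
    proof (intro equalityI subsetI)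
      fix e assume e: "e \<in> {e \<in> E. v \<in> e}"
      then have "card e = 2"
        using E(2) by simp
      then obtain a b where "e = {a, b}"
        by (auto simp: card_2_iff)
      then obtain w where "e = {v, w}"
        using e by auto
      then show "e \<in> (\<lambda>w. {v, w}) ` {w \<in> V. adjacent E v w}"
        using e E(1)[of e] by (auto simp: adjacent_def)
    qed (auto simp: adjacent_def)
  qed
  then have "(\<Sum>v\<in>V. card {w\<in>V. adjacent E v w}) = (\<Sum>v\<in>V. card {e\<in>E. v \<in> e})"
    by simp
  also have "\<dots> = (\<Sum>e\<in>E. card {v\<in>V. v \<in> e})"
    by (rule sum_card_swap[OF finV finE])
  also have "\<dots> = (\<Sum>e\<in>E. 2)"
  proof (rule sum.cong)
    fix e assume e: "e \<in> E"
    then have "{v\<in>V. v \<in> e} = e"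
      using E(1) by auto
    then show "card {v\<in>V. v \<in> e} = 2"
      using E(2)[OF e] by simp
  qed simp
  finally show ?thesis by simp
qed

lemma twice_card_edges_le:
  assumes "simple_graph V E"
  shows "2 * card E \<le> (card V)\<^sup>2"
proof -
  have "finite V"
    using assms by (simp add: simple_graph_def)
  then have "(\<Sum>v\<in>V. card {w\<in>V. adjacent E v w}) \<le> (\<Sum>v\<in>V. card V)"
    by (intro sum_mono card_mono) auto
  then show ?thesis
    by (simp add: sum_degrees[OF assms] power2_eq_square)
qed

text \<open>Sum \<open>f v <= f u\<close> over all pairs with \<open>u\<close> in \<open>R\<close>
  and \<open>v\<close> outside, then add \<open>card R * sum f R\<close> to both sides. This
  compares the average over \<open>V\<close> with that over \<open>R\<close>, cross-multiplied to
  stay within the natural numbers.\<close>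

lemma card_mult_sum_le_of_dominating:
  fixes f :: "'a \<Rightarrow> nat"
  assumes "finite V" "R \<subseteq> V" "\<And>u v. u \<in> R \<Longrightarrow> v \<in> V - R \<Longrightarrow> f v \<le> f u"
  shows "card R * sum f V \<le> card V * sum f R"
proof -
  have finR: "finite R"
    using assms finite_subset by blast
  have "(\<Sum>u\<in>R. \<Sum>v\<in>V - R. f v) \<le> (\<Sum>u\<in>R. \<Sum>v\<in>V - R. f u)"
    using assms(3) by (intro sum_mono) auto
  then have "card R * sum f (V - R) \<le> card (V - R) * sum f R"
    by (simp add: sum_distrib_left)
  moreover have "sum f V = sum f (V - R) + sum f R"
    using assms by (intro sum.subset_diff)
  moreover have "card V = card (V - R) + card R"
    using assms finR by (simp add: card_Diff_subset card_mono)
  ultimately show ?thesis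
    by (simp add: algebra_simps)
qed

text \<open>By Pascal's rule, one more element raises \<open>d choose q\<close> by
  \<open>d choose (q - 1)\<close>, which is at least 1 as soon as \<open>d >= q - 1\<close>. Smaller
  values are absorbed by the summand \<open>q - 1\<close>.\<close>

lemma le_binomial_plus:
  assumes "0 < q"
  shows "d \<le> (d choose q) + (q - 1)"
proof (induction d)
  case (Suc d)
  obtain k where k: "q = Suc k"
    using assms gr0_implies_Suc by blast
  show ?case
  proof (cases "k \<le> d")
    case True
    then have "0 < d choose k"
      by simp
    moreover have "Suc d choose q = (d choose k) + (d choose q)"
      using k by simp
    ultimately show ?thesis
      using Suc by linarith
  qed (use k in simp)
qed simp

text \<open>Both sides count the pairs of some \<open>w\<close> in \<open>W\<close> and a
  \<open>q\<close>-subset of \<open>R\<close> all of whose elements are related to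
  \<open>w\<close>.\<close>

lemma sum_binomial_eq_sum_common:
  assumes "finite R" "finite W"
  shows "(\<Sum>w\<in>W. card {u\<in>R. P u w} choose q) =
    (\<Sum>C\<in>{C. C \<subseteq> R \<and> card C = q}. card {w\<in>W. \<forall>u\<in>C. P u w})"
proof -
  have fin: "finite {C. C \<subseteq> R \<and> card C = q}"
    using assms(1) by (auto intro: finite_subset[of _ "Pow R"])
  have "(\<Sum>C\<in>{C. C \<subseteq> R \<and> card C = q}. card {w\<in>W. \<forall>u\<in>C. P u w}) =
      (\<Sum>w\<in>W. card {C \<in> {C. C \<subseteq> R \<and> card C = q}. \<forall>u\<in>C. P u w})"
    by (rule sum_card_swap[OF fin assms(2)])
  also have "\<dots> = (\<Sum>w\<in>W. card {u\<in>R. P u w} choose q)"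
  proof (rule sum.cong)
    fix w
    have "{C \<in> {C. C \<subseteq> R \<and> card C = q}. \<forall>u\<in>C. P u w} = {C. C \<subseteq> {u\<in>R. P u w} \<and> card C = q}"
      by auto
    then show "card {C \<in> {C. C \<subseteq> R \<and> card C = q}. \<forall>u\<in>C. P u w} = card {u\<in>R. P u w} choose q"
      using assms(1) by (simp add: n_subsets)
  qed simp
  finally show ?thesis by simp
qed

lemma edges_bound_if_no_biclique:
  assumes G: "simple_graph V E" and R: "R \<subseteq> V" and q: "0 < q"
    and high: "\<And>u v. u \<in> R \<Longrightarrow> v \<in> V - R \<Longrightarrow>
       card {w\<in>V. adjacent E v w} \<le> card {w\<in>V. adjacent E u w}"
    and few: "\<And>C. C \<subseteq> R \<Longrightarrow> card C = q \<Longrightarrow> card {w\<in>V - R. \<forall>u\<in>C. adjacent E u w} < q"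
  shows "card R * (2 * card E) \<le>
    card V * ((card R)\<^sup>2 + (q - 1) * card V + (q - 1) * (card R choose q))"
proof -
  have finV: "finite V"
    using G by (simp add: simple_graph_def)
  then have finR: "finite R" and finW: "finite (V - R)"
    using R finite_subset by auto
  have "(\<Sum>w\<in>V - R. card {u\<in>R. adjacent E u w}) \<le>
      (\<Sum>w\<in>V - R. (card {u\<in>R. adjacent E u w} choose q) + (q - 1))"
    by (intro sum_mono le_binomial_plus q)
  also have "\<dots> = (\<Sum>C\<in>{C. C \<subseteq> R \<and> card C = q}. card {w\<in>V - R. \<forall>u\<in>C. adjacent E u w})
      + card (V - R) * (q - 1)"
    by (simp add: sum.distrib sum_binomial_eq_sum_common[OF finR finW])
  also have "\<dots> \<le> (\<Sum>C\<in>{C. C \<subseteq> R \<and> card C = q}. q - 1) + card V * (q - 1)"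
  proof (intro add_mono sum_mono mult_right_mono)
    fix C assume "C \<in> {C. C \<subseteq> R \<and> card C = q}"
    then show "card {w\<in>V - R. \<forall>u\<in>C. adjacent E u w} \<le> q - 1"
      using few[of C] by simp
  qed (use finV in \<open>auto intro: card_mono\<close>)
  also have "\<dots> = (q - 1) * (card R choose q) + (q - 1) * card V"
    using finR by (simp add: n_subsets)
  finally have cross: "(\<Sum>w\<in>V - R. card {u\<in>R. adjacent E u w}) \<le>
      (q - 1) * (card R choose q) + (q - 1) * card V" .
  \<comment> \<open>A vertex has at most \<open>card R\<close> neighbours inside \<open>R\<close>,
    so leaving these out costs at most \<open>(card R)^2\<close> of the degree sum.\<close>
  have "card {w\<in>V. adjacent E u w} \<le> card {w\<in>V - R. adjacent E u w} + card R" for u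
  proof -
    have "card {w\<in>V. adjacent E u w} \<le> card ({w\<in>V - R. adjacent E u w} \<union> R)"
      using finV finR by (intro card_mono) auto
    also have "\<dots> \<le> card {w\<in>V - R. adjacent E u w} + card R"
      by (rule card_Un_le)
    finally show ?thesis .
  qed
  then have "(\<Sum>u\<in>R. card {w\<in>V. adjacent E u w}) \<le>
      (\<Sum>u\<in>R. card {w\<in>V - R. adjacent E u w} + card R)"
    by (intro sum_mono)
  also have "\<dots> = (\<Sum>w\<in>V - R. card {u\<in>R. adjacent E u w}) + (card R)\<^sup>2"
    unfolding sum.distrib sum_card_swap[OF finR finW] by (simp add: power2_eq_square)
  finally have "(\<Sum>u\<in>R. card {w\<in>V. adjacent E u w}) \<le>
      (card R)\<^sup>2 + (q - 1) * card V + (q - 1) * (card R choose q)"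
    using cross by linarith
  then have "card V * (\<Sum>u\<in>R. card {w\<in>V. adjacent E u w}) \<le>
      card V * ((card R)\<^sup>2 + (q - 1) * card V + (q - 1) * (card R choose q))"
    by (rule mult_left_mono) simp
  moreover have "card R * (2 * card E) \<le> card V * (\<Sum>u\<in>R. card {w\<in>V. adjacent E u w})"
    using card_mult_sum_le_of_dominating[of V R "\<lambda>v. card {w\<in>V. adjacent E v w}", OF finV R high]
    by (simp add: sum_degrees[OF G])
  ultimately show ?thesis
    by linarith
qed

section \<open>The parameters\<close>

text \<open>Put \<open>t = q / r <= 1\<close>. Then \<open>t ^ q <= t ^ i\<close> for
  \<open>i <= q\<close>, so the sum times \<open>t ^ q\<close> is at most
  \<open>(1 + t) ^ r <= exp (t * r) = exp q\<close>.\<close>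

lemma sum_binomial_le_exp:
  assumes "0 < q" "q \<le> r"
  shows "(\<Sum>i\<le>q. real (r choose i)) \<le> (exp 1 * real r / real q) ^ q"
proof -
  define t where "t = real q / real r"
  have t: "0 < t" "t \<le> 1" and r: "0 < r"
    using assms by (auto simp: t_def)
  have "(\<Sum>i\<le>q. real (r choose i)) * t ^ q = (\<Sum>i\<le>q. real (r choose i) * t ^ q)"
    by (simp add: sum_distrib_right)
  also have "\<dots> \<le> (\<Sum>i\<le>q. real (r choose i) * t ^ i)"
    using t by (intro sum_mono mult_left_mono power_decreasing) auto
  also have "\<dots> \<le> (\<Sum>i\<le>r. real (r choose i) * t ^ i)"
    using assms t by (intro sum_mono2) auto
  also have "\<dots> = (t + 1) ^ r"
    by (simp add: binomial_ring)
  also have "\<dots> \<le> exp t ^ r"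
    using t by (intro power_mono) (auto simp: exp_ge_add_one_self add.commute)
  also have "\<dots> = exp 1 ^ q"
    using r by (simp add: t_def flip: exp_of_nat_mult)
  finally have "(\<Sum>i\<le>q. real (r choose i)) \<le> exp 1 ^ q / t ^ q"
    using t by (simp add: field_simps)
  then show ?thesis
    by (simp add: t_def power_divide power_mult_distrib)
qed

section \<open>\<open>q\<close> as the largest admissible exponent, and the rounding of
  \<open>r\<close>\<close>

lemma two_le_square_div:
  assumes "0 < m" "2 * m \<le> n\<^sup>2"
  shows "2 \<le> (real n)\<^sup>2 / real m"
proof -
  have "real (2 * m) \<le> real (n\<^sup>2)"
    using assms(2) of_nat_le_iff by blast
  then show ?thesis
    using assms(1) by (simp add: field_simps)
qed

lemma fb_q_base_gt_1:
  assumes "0 < m" "2 * m \<le> n\<^sup>2"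
  shows "1 < 2 * exp 1 * (real n)\<^sup>2 / real m"
proof -
  have "2 * 2 \<le> exp 1 * ((real n)\<^sup>2 / real m)"
    using exp_ge_add_one_self[of 1] two_le_square_div[OF assms] by (intro mult_mono) auto
  then show ?thesis by simp
qed

text \<open>Together with \<open>le_fb_q\<close> this makes \<open>fb_q n m\<close> the largest
  \<open>k\<close> with \<open>(2 e x)^k <= n / 2\<close>. All later estimates use this description
  instead of the logarithms.\<close>

lemma fb_q_power_le:
  assumes "2 \<le> n" "0 < m" "2 * m \<le> n\<^sup>2"
  shows "(2 * exp 1 * (real n)\<^sup>2 / real m) ^ fb_q n m \<le> real n / 2"
proof -
  define y where "y = 2 * exp 1 * (real n)\<^sup>2 / real m"
  have y: "1 < y"
    unfolding y_def by (rule fb_q_base_gt_1[OF assms(2,3)])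
  \<comment> \<open>A negative quotient would be raised to 0 by \<open>nat\<close>, and the upper
    bound would fail; \<open>n >= 2\<close> excludes this.\<close>
  have "0 \<le> ln (real n / 2) / ln y"
    using assms(1) y by simp
  then have "real (fb_q n m) \<le> ln (real n / 2) / ln y"
    unfolding fb_q_def y_def[symmetric] by linarith
  then have "real (fb_q n m) * ln y \<le> ln (real n / 2)"
    using y by (simp add: field_simps)
  then have "exp (real (fb_q n m) * ln y) \<le> exp (ln (real n / 2))"
    by simp
  then show ?thesis
    unfolding y_def[symmetric] using y assms(1) by (simp add: exp_of_nat_mult)
qed

lemma le_fb_q:
  assumes "2 \<le> n" "0 < m" "2 * m \<le> n\<^sup>2"
    and le: "(2 * exp 1 * (real n)\<^sup>2 / real m) ^ k \<le> real n / 2"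
  shows "k \<le> fb_q n m"
proof -
  define y where "y = 2 * exp 1 * (real n)\<^sup>2 / real m"
  have y: "1 < y"
    unfolding y_def by (rule fb_q_base_gt_1[OF assms(2,3)])
  have "ln (y ^ k) \<le> ln (real n / 2)"
    using le y assms(1) unfolding y_def[symmetric] by (intro ln_mono) auto
  then have "real k \<le> ln (real n / 2) / ln y"
    using y by (simp add: ln_realpow field_simps)
  then show ?thesis
    unfolding fb_q_def y_def[symmetric] by linarith
qed

lemma fb_r_bounds:
  shows "real (fb_r n m) \<le> real (fb_q n m) * ((real n)\<^sup>2 / real m)"
    and "real (fb_q n m) * ((real n)\<^sup>2 / real m) < real (fb_r n m) + 1"
proof -
  have "0 \<le> real (fb_q n m) * (real n)\<^sup>2 / real m"
    by simp
  then show "real (fb_r n m) \<le> real (fb_q n m) * ((real n)\<^sup>2 / real m)"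
    and "real (fb_q n m) * ((real n)\<^sup>2 / real m) < real (fb_r n m) + 1"
    unfolding fb_r_def times_divide_eq_right by linarith+
qed

text \<open>From \<open>2 <= x\<close> follows \<open>2 q <= q x < r + 1\<close>. The result makes
  \<open>sum_binomial_le_exp\<close> applicable.\<close>

lemma fb_q_le_fb_r:
  assumes "0 < m" "2 * m \<le> n\<^sup>2"
  shows "fb_q n m \<le> fb_r n m"
proof -
  have "real (fb_q n m) * 2 \<le> real (fb_q n m) * ((real n)\<^sup>2 / real m)"
    by (intro mult_left_mono two_le_square_div assms) simp
  then show ?thesis
    using fb_r_bounds(2)[of n m] by linarith
qed

text \<open>Since \<open>r / q <= x\<close>, the sum is at most \<open>(e x)^q\<close>, and the
  factor 2 in the base \<open>2 e x\<close> pays for \<open>2 ^ q\<close>. That power absorbs the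
  factor \<open>q - 1\<close> in the edge bound and yields \<open>q <= n\<close> for the running
  time.\<close>

lemma sum_binomial_fb_le:
  assumes "2 \<le> n" "0 < m" "2 * m \<le> n\<^sup>2"
  shows "2 ^ fb_q n m * (\<Sum>i\<le>fb_q n m. real (fb_r n m choose i)) \<le> real n / 2"
proof (cases "fb_q n m = 0")
  case True
  then show ?thesis
    using assms(1) by simp
next
  case False
  define q r x where "q = fb_q n m" and "r = fb_r n m" and "x = (real n)\<^sup>2 / real m"
  have q: "0 < q" "q \<le> r"
    using False fb_q_le_fb_r[OF assms(2,3)] by (auto simp: q_def r_def)
  have "real r / real q \<le> x"
    using fb_r_bounds(1)[of n m] q by (simp add: q_def r_def x_def field_simps)
  then have "exp 1 * real r / real q \<le> exp 1 * x"
    by (simp flip: times_divide_eq_right)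
  then have "(exp 1 * real r / real q) ^ q \<le> (exp 1 * x) ^ q"
    by (intro power_mono) auto
  then have "(\<Sum>i\<le>q. real (r choose i)) \<le> (exp 1 * x) ^ q"
    using sum_binomial_le_exp[OF q] by linarith
  then have "2 ^ q * (\<Sum>i\<le>q. real (r choose i)) \<le> 2 ^ q * (exp 1 * x) ^ q"
    by (intro mult_left_mono) auto
  also have "\<dots> = (2 * exp 1 * (real n)\<^sup>2 / real m) ^ q"
    unfolding x_def power_mult_distrib[symmetric] by (simp add: mult.assoc)
  also have "\<dots> \<le> real n / 2"
    unfolding q_def by (rule fb_q_power_le[OF assms])
  finally show ?thesis
    by (simp add: q_def r_def)
qed

section \<open>Consequences of the density hypotheses\<close>

lemma dense_edges_pos:
  assumes "2 \<le> n" "real m \<ge> 3 * real n powr (3/2)"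
  shows "0 < m"
proof -
  have "0 < real n powr (3/2)"
    using assms(1) by simp
  then show ?thesis
    using assms(2) by (cases m) auto
qed

lemma powr_3_half: "real n powr (3/2) = sqrt (real n) ^ 3"
proof (cases "n = 0")
  case False
  then have "sqrt (real n) ^ 3 = (real n powr (1/2)) powr 3"
    by (simp add: powr_half_sqrt)
  then show ?thesis
    by (simp only: powr_powr) simp
qed simp

text \<open>Multiplying the hypothesis by \<open>sqrt n\<close> turns \<open>n powr (3/2)\<close>
  into \<open>n^2\<close>. The density enters as this bound on \<open>x\<close>, with
  \<open>c = 3\<close> or \<open>c = 8\<close>.\<close>

lemma square_div_le_of_edges:
  assumes "0 < c" "0 < n" "real m \<ge> c * real n powr (3/2)"
  shows "(real n)\<^sup>2 / real m \<le> sqrt (real n) / c"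
proof -
  have s: "0 < sqrt (real n)"
    using assms by simp
  then have "0 < c * sqrt (real n) ^ 3"
    using assms by simp
  then have m: "0 < real m"
    using assms unfolding powr_3_half by linarith
  have "sqrt (real n) * (c * sqrt (real n) ^ 3) \<le> sqrt (real n) * real m"
    using assms s unfolding powr_3_half by (intro mult_left_mono) auto
  moreover have "sqrt (real n) * (c * sqrt (real n) ^ 3) = c * (real n)\<^sup>2"
  proof -
    have "sqrt (real n) * (c * sqrt (real n) ^ 3) = c * ((sqrt (real n))\<^sup>2)\<^sup>2"
      by (simp add: power2_eq_square power3_eq_cube)
    then show ?thesis by simp
  qed
  ultimately show ?thesis
    using m assms(1) by (simp add: field_simps)
qed

text \<open>The 32nd power of \<open>1 - 1/16 <= exp (- 1/16)\<close> bounds \<open>exp (-2)\<close>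
  from below by a rational number that exceeds \<open>1/8\<close>.\<close>

lemma exp_1_squared_le_8: "(exp 1 :: real)\<^sup>2 \<le> 8"
proof -
  have "(15/16 :: real) ^ 32 \<le> exp (- (1/16)) ^ 32"
    using exp_ge_add_one_self[of "- (1/16) :: real"] by (intro power_mono) auto
  also have "\<dots> = 1 / (exp 1)\<^sup>2"
    by (simp add: exp_minus field_simps flip: exp_of_nat_mult exp_add)
  finally have "(exp 1 :: real)\<^sup>2 \<le> 1 / (15/16) ^ 32"
    by (simp add: field_simps)
  also have "\<dots> \<le> 8"
    by (simp add: field_simps)
  finally show ?thesis .
qed

lemma fb_q_pos:
  assumes "2 \<le> n" "2 * m \<le> n\<^sup>2" "real m \<ge> 3 * real n powr (3/2)"
  shows "0 < fb_q n m"
proof -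
  define s where "s = sqrt (real n)"
  have s: "0 < s" "s\<^sup>2 = real n"
    using assms(1) by (auto simp: s_def)
  have m: "0 < m"
    by (rule dense_edges_pos[OF assms(1,3)])
  have x: "(real n)\<^sup>2 / real m \<le> s / 3"
    unfolding s_def using assms by (intro square_div_le_of_edges) auto
  \<comment> \<open>\<open>2 <= x <= s / 3\<close>: a graph this dense has at least 36
    vertices.\<close>
  then have "6 \<le> s"
    using two_le_square_div[OF m assms(2)] by linarith
  have "exp 1 * ((real n)\<^sup>2 / real m) \<le> 3 * (s / 3)"
    using x exp_le s by (intro mult_mono) auto
  then have "2 * exp 1 * (real n)\<^sup>2 / real m \<le> 2 * s"
    by simp
  also have "\<dots> \<le> s\<^sup>2 / 2"
    using \<open>6 \<le> s\<close> by (simp add: power2_eq_square)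
  finally have "1 \<le> fb_q n m"
    using s by (intro le_fb_q[OF assms(1) m assms(2)]) simp
  then show ?thesis by simp
qed

text \<open>With \<open>x <= sqrt n / 8\<close> the square of \<open>2 e x\<close> is at most
  \<open>e^2 n / 16\<close>, and \<open>e^2 <= 8\<close> brings this down to
  \<open>n / 2\<close>.\<close>

lemma fb_q_ge_2:
  assumes "2 \<le> n" "2 * m \<le> n\<^sup>2" "real m > 8 * real n powr (3/2)"
  shows "2 \<le> fb_q n m"
proof -
  have m: "0 < m"
    using assms(3) powr_ge_zero[of "real n" "3/2"] by (cases m) (auto simp: not_less)
  have "exp 1 * ((real n)\<^sup>2 / real m) \<le> exp 1 * (sqrt (real n) / 8)"
    using assms by (intro mult_left_mono square_div_le_of_edges) auto
  then have "2 * exp 1 * (real n)\<^sup>2 / real m \<le> exp 1 * sqrt (real n) / 4"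
    by (simp add: mult_ac)
  then have "(2 * exp 1 * (real n)\<^sup>2 / real m)\<^sup>2 \<le> (exp 1 * sqrt (real n) / 4)\<^sup>2"
    by (intro power_mono) auto
  also have "\<dots> = (exp 1)\<^sup>2 * (real n / 16)"
    by (simp add: power_mult_distrib power_divide)
  also have "\<dots> \<le> 8 * (real n / 16)"
    by (intro mult_right_mono exp_1_squared_le_8) simp
  finally show ?thesis
    by (intro le_fb_q[OF assms(1) m assms(2)]) simp
qed

text \<open>This is behind both \<open>r <= n\<close> and \<open>r^2 <= q n / 2\<close>. For
  \<open>q >= 2\<close> one has \<open>q <= (2 e)^q\<close> and \<open>x^2 <= x^q\<close>, and the
  product is \<open>(2 e x)^q <= n / 2\<close>. For \<open>q = 1\<close> the exponent is too small,
  and \<open>x <= sqrt n / 3\<close> is used instead.\<close>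

lemma fb_q_mult_square_le:
  assumes "2 \<le> n" "2 * m \<le> n\<^sup>2" "real m \<ge> 3 * real n powr (3/2)"
  shows "real (fb_q n m) * ((real n)\<^sup>2 / real m)\<^sup>2 \<le> real n / 2"
proof -
  define q x where "q = fb_q n m" and "x = (real n)\<^sup>2 / real m"
  have m: "0 < m"
    by (rule dense_edges_pos[OF assms(1,3)])
  have x: "2 \<le> x"
    unfolding x_def by (rule two_le_square_div[OF m assms(2)])
  have q: "0 < q"
    unfolding q_def by (rule fb_q_pos[OF assms])
  show ?thesis
  proof (cases "q = 1")
    case True
    have "x \<le> sqrt (real n) / 3"
      unfolding x_def using assms by (intro square_div_le_of_edges) auto
    then have "x\<^sup>2 \<le> (sqrt (real n) / 3)\<^sup>2"
      using x by (intro power_mono) auto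
    also have "\<dots> = real n / 9"
      by (simp add: power_divide)
    finally show ?thesis
      using True by (simp add: q_def x_def)
  next
    case False
    have "real q \<le> 2 ^ q"
      using less_exp[of q] by (metis less_imp_le of_nat_le_iff of_nat_numeral of_nat_power)
    also have "\<dots> \<le> (2 * exp 1) ^ q"
      by (intro power_mono) auto
    finally have "real q * x\<^sup>2 \<le> (2 * exp 1) ^ q * x ^ q"
      using x q False by (intro mult_mono power_increasing) auto
    also have "\<dots> = (2 * exp 1 * (real n)\<^sup>2 / real m) ^ q"
      unfolding x_def power_mult_distrib[symmetric] by (simp add: mult.assoc)
    also have "\<dots> \<le> real n / 2"
      unfolding q_def by (rule fb_q_power_le[OF assms(1) m assms(2)])
    finally show ?thesis
      by (simp add: q_def x_def)
  qed
qed

text \<open>Guarantees that \<open>r\<close> vertices can be chosen: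
  \<open>r <= q x <= q x^2 <= n / 2\<close>.\<close>

lemma fb_r_le:
  assumes "2 \<le> n" "2 * m \<le> n\<^sup>2" "real m \<ge> 3 * real n powr (3/2)"
  shows "fb_r n m \<le> n"
proof -
  define x where "x = (real n)\<^sup>2 / real m"
  have m: "0 < m"
    by (rule dense_edges_pos[OF assms(1,3)])
  have x: "2 \<le> x"
    unfolding x_def by (rule two_le_square_div[OF m assms(2)])
  then have "x \<le> x\<^sup>2"
    by (simp add: power2_eq_square)
  then have "real (fb_q n m) * x \<le> real (fb_q n m) * x\<^sup>2"
    by (intro mult_left_mono) auto
  then show ?thesis
    using fb_q_mult_square_le[OF assms] fb_r_bounds(1)[of n m] by (simp add: x_def)
qed

lemma fb_edges_bound_violated:
  assumes n: "2 \<le> n" and mn: "2 * m \<le> n\<^sup>2" and dense: "real m \<ge> 3 * real n powr (3/2)"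
  defines "q \<equiv> fb_q n m" and "r \<equiv> fb_r n m"
  shows "n * (r\<^sup>2 + (q - 1) * n + (q - 1) * (r choose q)) < r * (2 * m)"
proof (rule ccontr)
  define x where "x = (real n)\<^sup>2 / real m"
  have m: "0 < m"
    by (rule dense_edges_pos[OF n dense])
  have x: "2 \<le> x"
    unfolding x_def by (rule two_le_square_div[OF m mn])
  have q: "0 < q"
    unfolding q_def by (rule fb_q_pos[OF n mn dense])
  have mx: "real m = (real n)\<^sup>2 / x"
    using m n by (simp add: x_def)
  have "real (r choose q) \<le> (\<Sum>i\<le>q. real (r choose i))"
    by (rule member_le_sum) auto
  then have "2 ^ q * real (r choose q) \<le> 2 ^ q * (\<Sum>i\<le>q. real (r choose i))"
    by (intro mult_left_mono) auto
  also have "\<dots> \<le> real n / 2"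
    unfolding q_def r_def by (rule sum_binomial_fb_le[OF n m mn])
  finally have 1: "2 ^ q * real (r choose q) \<le> real n / 2" .
  have "real q \<le> 2 ^ q"
    using less_exp[of q] by (metis less_imp_le of_nat_le_iff of_nat_numeral of_nat_power)
  then have "real q - 1 \<le> 2 ^ q"
    by linarith
  then have "(real q - 1) * real (r choose q) \<le> 2 ^ q * real (r choose q)"
    by (intro mult_right_mono) auto
  with 1 have binom: "(real q - 1) * real (r choose q) \<le> real n / 2"
    by linarith
  have rx: "real r \<le> real q * x" "real q * x < real r + 1"
    using fb_r_bounds[of n m] by (auto simp: q_def r_def x_def)
  have "(real r)\<^sup>2 \<le> (real q * x)\<^sup>2"
    using rx by (intro power_mono) auto
  also have "\<dots> = real q * (real q * x\<^sup>2)"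
    by (simp add: power2_eq_square)
  also have "\<dots> \<le> real q * (real n / 2)"
    using fb_q_mult_square_le[OF n mn dense] by (intro mult_left_mono) (auto simp: q_def x_def)
  finally have rsq: "(real r)\<^sup>2 \<le> real q * (real n / 2)" .
  assume "\<not> ?thesis"
  then have "real (r * (2 * m)) \<le> real (n * (r\<^sup>2 + (q - 1) * n + (q - 1) * (r choose q)))"
    by (simp only: of_nat_le_iff not_less)
  then have "real n * (2 * real r * (real n / x)) \<le>
      real n * ((real r)\<^sup>2 + (real q - 1) * real n + (real q - 1) * real (r choose q))"
    using q by (simp add: mx of_nat_diff power2_eq_square mult_ac)
  then have "2 * real r * (real n / x) \<le>
      (real r)\<^sup>2 + (real q - 1) * real n + (real q - 1) * real (r choose q)"
    by (rule mult_left_le_imp_le) (use n in simp)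
  also have "\<dots> \<le> real q * (real n / 2) + (real q - 1) * real n + real n / 2"
    using rsq binom by linarith
  finally have "2 * (real r / x) * real n \<le> (3 / 2 * real q - 1 / 2) * real n"
    by (simp add: field_simps)
  then have le: "2 * (real r / x) \<le> 3 / 2 * real q - 1 / 2"
    by (rule mult_right_le_imp_le) (use n in simp)
  \<comment> \<open>Rounding down costs \<open>r / x\<close> less than
    \<open>1 / x <= 1 / 2\<close>, so \<open>2 r / x > 2 q - 1\<close>. With \<open>le\<close> this
    gives \<open>q < 1\<close>. At \<open>q = 1\<close> both bounds equal 1, so the strict
    inequality matters.\<close>
  have "real q < (real r + 1) / x"
    using rx(2) x by (simp add: field_simps)
  then have "real q < real r / x + 1 / x"
    by (simp add: add_divide_distrib)
  moreover have "1 / x \<le> 1 / 2"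
    using x by simp
  ultimately show False
    using le q by linarith
qed

section \<open>Correctness of the algorithm\<close>

lemma val_find_bipartite:
  "val (find_bipartite adj vs q r) =
     (let R = val (highest_degree_t adj vs r) in
      val (search_t adj q (filter (\<lambda>v. v \<notin> set R) vs) (val (subsets_t q R))))"
  by (simp add: find_bipartite_def Let_def)

lemma find_bipartite_returns_biclique:
  assumes G: "simple_graph V E" and vs: "distinct vs" "set vs = V"
    and r: "r \<le> card V" and q: "0 < q"
    and many: "card V * (r\<^sup>2 + (q - 1) * card V + (q - 1) * (r choose q)) < r * (2 * card E)"
  shows "\<exists>C D. val (find_bipartite (adjacent E) vs q r) = Some (C, D) \<and>
    complete_bipartite_in V E q (set C) (set D)"
proof -
  define R where "R = val (highest_degree_t (adjacent E) vs r)"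
  define W where "W = filter (\<lambda>v. v \<notin> set R) vs"
  define Cs where "Cs = val (subsets_t q R)"
  define D where "D C = filter (\<lambda>w. \<forall>v\<in>set C. adjacent E v w) W" for C
  have "r \<le> length vs"
    using r vs distinct_card by metis
  note R = highest_degree_t_correct[OF vs(1) this, where adj = "adjacent E", folded R_def]
  have cardR: "card (set R) = r"
    using R(1,2) distinct_card by metis
  have Cs: "set ` set Cs = {C. C \<subseteq> set R \<and> card C = q}"
    unfolding Cs_def by (rule subsets_t_correct[OF R(1)])
  have setW: "set W = V - set R" and distW: "distinct W"
    using vs by (auto simp: W_def)
  have val: "val (find_bipartite (adjacent E) vs q r) =
      map_option (\<lambda>C. (C, take q (D C))) (find (\<lambda>C. q \<le> length (D C)) Cs)"
    by (simp only: val_find_bipartite Let_def search_t_correct R_def W_def Cs_def D_def)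
  \<comment> \<open>If the search rejected every \<open>C\<close>, all \<open>q\<close>-subsets of
    \<open>R\<close> would have fewer than \<open>q\<close> common neighbours outside
    \<open>R\<close>, and the edge bound would contradict \<open>many\<close>.\<close>
  have "\<exists>C\<in>set Cs. q \<le> length (D C)"
  proof (rule ccontr)
    assume neg: "\<not> ?thesis"
    have "card {w\<in>V - set R. \<forall>u\<in>C. adjacent E u w} < q" if "C \<subseteq> set R" "card C = q" for C
    proof -
      obtain xs where xs: "xs \<in> set Cs" "C = set xs"
        using Cs \<open>C \<subseteq> set R\<close> \<open>card C = q\<close> by blast
      have "{w\<in>V - set R. \<forall>u\<in>C. adjacent E u w} = set (D xs)"
        using setW xs by (auto simp: D_def)
      then have "card {w\<in>V - set R. \<forall>u\<in>C. adjacent E u w} \<le> length (D xs)"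
        using card_length by metis
      then show ?thesis
        using neg xs(1) by force
    qed
    then have "card (set R) * (2 * card E) \<le>
        card V * ((card (set R))\<^sup>2 + (q - 1) * card V + (q - 1) * (card (set R) choose q))"
      using R(3,4) vs(2) by (intro edges_bound_if_no_biclique[OF G _ q]) auto
    then show False
      using many cardR by simp
  qed
  then obtain C where C: "find (\<lambda>C. q \<le> length (D C)) Cs = Some C"
    by (cases "find (\<lambda>C. q \<le> length (D C)) Cs") (auto simp: find_None_iff)
  then have CCs: "C \<in> set Cs" and len: "q \<le> length (D C)"
    by (auto simp: find_Some_iff)
  have "set C \<subseteq> set R" "card (set C) = q"
    using Cs CCs by auto
  \<comment> \<open>Without repetitions, the first \<open>q\<close> entries form a set of exactly
    \<open>q\<close> vertices.\<close>
  moreover have "distinct (take q (D C))"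
    using distW by (simp add: D_def)
  then have "card (set (take q (D C))) = q"
    using len by (simp add: distinct_card)
  moreover have "set (take q (D C)) \<subseteq> set (D C)"
    by (rule set_take_subset)
  ultimately have "complete_bipartite_in V E q (set C) (set (take q (D C)))"
    using setW R(3) vs(2) by (auto simp: complete_bipartite_in_def D_def)
  then show ?thesis
    using val C by auto
qed

section \<open>Running time\<close>

lemma time_basic:
  "time (member_t x xs) \<le> length xs + 1"
  "time (length_t xs) = length xs + 1"
  "time (append_t xs ys) = length xs + 1"
  "time (vertices_t ps) = length ps + 1"
  "time (cons_all_t x Cs) = length Cs + 1"
  "time (degree_t adj v xs) = length xs + 1"
  "time (neighbours_t adj v xs) = length xs + 1"
  "time (insert_t p ps) \<le> length ps + 1"
proof -
  show "time (member_t x xs) \<le> length xs + 1" by (induction xs) auto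
  show "time (length_t xs) = length xs + 1" by (induction xs) auto
  show "time (append_t xs ys) = length xs + 1" by (induction xs) auto
  show "time (vertices_t ps) = length ps + 1" by (induction ps) auto
  show "time (cons_all_t x Cs) = length Cs + 1" by (induction Cs) auto
  show "time (degree_t adj v xs) = length xs + 1" by (induction xs) auto
  show "time (neighbours_t adj v xs) = length xs + 1" by (induction xs) auto
  show "time (insert_t p ps) \<le> length ps + 1" by (induction ps) auto
qed

lemma time_take_t: "time (take_t k xs) \<le> length xs + 1"
  by (induction k xs rule: take_t.induct) auto

lemma time_degrees_t: "time (degrees_t adj vs us) = length us * (length vs + 2) + 1"
  by (induction us) (auto simp: time_basic)

lemma time_sort_t: "time (sort_t ps) \<le> (length ps + 1)\<^sup>2"
proof (induction ps)
  case (Cons p ps)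
  have "time (insert_t p (sort_key (\<lambda>p. - int (fst p)) ps)) \<le> length ps + 1"
    using time_basic(8)[of p "sort_key (\<lambda>p. - int (fst p)) ps"] by simp
  with Cons show ?case
    by (simp add: power2_eq_square)
qed simp

lemma time_remove_t: "time (remove_t R vs) \<le> length vs * (length R + 2) + 1"
proof (induction vs)
  case (Cons v vs)
  then show ?case
    using time_basic(1)[of v R] by simp
qed simp

lemma time_common_t: "time (common_t adj C W) \<le> length C * (length W + 2) + 1"
proof (induction C arbitrary: W)
  case (Cons v C)
  define W' where "W' = val (neighbours_t adj v W)"
  have "W' = filter (adj v) W"
    unfolding W'_def by (induction W) auto
  \<comment> \<open>Filtering only shortens the list, so every round can be charged at the length of
    the original \<open>W\<close>.\<close>
  then have "length C * (length W' + 2) + 1 \<le> length C * (length W + 2) + 1"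
    by (intro add_right_mono mult_left_mono) auto
  from le_trans[OF Cons[of W'] this] show ?case
    by (simp add: W'_def[symmetric] time_basic)
qed simp

section \<open>Cost of enumerating and testing the subsets\<close>

lemma length_subsets_t: "length (val (subsets_t k xs)) = length xs choose k"
  by (induction k xs rule: subsets_t.induct) auto

lemma length_in_subsets_t: "C \<in> set (val (subsets_t k xs)) \<Longrightarrow> length C = k"
  by (induction k xs arbitrary: C rule: subsets_t.induct) auto

text \<open>Pascal's rule summed over \<open>i\<close>; the two sums on the right match the two
  recursive calls of \<open>subsets_t\<close>.\<close>

lemma sum_binomial_Suc_Suc:
  "(\<Sum>i\<le>Suc k. Suc l choose i) = (\<Sum>i\<le>k. l choose i) + (\<Sum>i\<le>Suc k. l choose i)"
proof -
  have "(\<Sum>i\<le>Suc k. Suc l choose i) = 1 + (\<Sum>i\<le>k. Suc l choose Suc i)"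
    by (subst sum.atMost_Suc_shift) simp
  also have "\<dots> = (\<Sum>i\<le>k. l choose i) + (1 + (\<Sum>i\<le>k. l choose Suc i))"
    by (simp add: sum.distrib)
  also have "1 + (\<Sum>i\<le>k. l choose Suc i) = (\<Sum>i\<le>Suc k. l choose i)"
    by (subst sum.atMost_Suc_shift) simp
  finally show ?thesis .
qed

text \<open>
  The recursion of \<open>subsets_t\<close> does not stop when fewer than \<open>k\<close> elements are left, so its leaves
  correspond to all subsets of size at most \<open>k\<close>, not only to those of size \<open>k\<close>.
\<close>

lemma time_subsets_t:
  "time (subsets_t k xs) \<le> 5 * (length xs + 1) * (\<Sum>i\<le>k. length xs choose i)"
proof (induction k xs rule: subsets_t.induct)
  case (2 k)
  have "(\<Sum>i\<le>Suc k. (0::nat) choose i) = 1"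
    by (subst sum.atMost_Suc_shift) simp
  then show ?case by simp
next
  case (3 k x xs)
  define l S1 S2 where "l = length xs" and "S1 = (\<Sum>i\<le>k. l choose i)"
    and "S2 = (\<Sum>i\<le>Suc k. l choose i)"
  have "l choose k \<le> S1"
    unfolding S1_def by (rule member_le_sum) auto
  moreover have "1 \<le> S2"
    unfolding S2_def by (subst sum.atMost_Suc_shift) simp
  moreover have "time (subsets_t (Suc k) (x # xs)) =
      time (subsets_t k xs) + time (subsets_t (Suc k) xs) + 2 * (l choose k) + 3"
    by (simp add: time_basic length_subsets_t l_def)
  moreover have "time (subsets_t k xs) \<le> 5 * (l + 1) * S1"
      "time (subsets_t (Suc k) xs) \<le> 5 * (l + 1) * S2"
    using 3 by (simp_all only: l_def S1_def S2_def)
  \<comment> \<open>The overhead \<open>2 * (l choose k) + 3\<close> of \<open>cons_all_t\<close>,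
    \<open>append_t\<close> and the call itself is at most \<open>2 * S1 + 3 * S2\<close>; hence the
    factor 5.\<close>
  ultimately have "time (subsets_t (Suc k) (x # xs)) \<le>
      5 * (l + 1) * S1 + 5 * (l + 1) * S2 + 5 * (S1 + S2)"
    by presburger
  also have "\<dots> = 5 * (Suc l + 1) * (S1 + S2)"
    by (simp add: algebra_simps)
  finally show ?case
    by (simp only: l_def S1_def S2_def sum_binomial_Suc_Suc list.size(4) add_0_right add_Suc_right One_nat_def)
qed simp

text \<open>Each \<open>C\<close> pays for intersecting and measuring. The final
  \<open>take_t\<close> happens at most once and is covered by the additive
  \<open>length W + 2\<close>.\<close>

lemma time_search_t:
  assumes "\<And>C. C \<in> set Cs \<Longrightarrow> length C = q"
  shows "time (search_t adj q W Cs) \<le> length Cs * ((q + 2) * (length W + 2)) + length W + 2"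
  using assms
proof (induction Cs)
  case (Cons C Cs)
  define D where "D = val (common_t adj C W)"
  have D: "length D \<le> length W"
    by (simp add: D_def)
  have *: "time (common_t adj C W) \<le> q * (length W + 2) + 1"
    using time_common_t[of adj C W] Cons.prems[of C] by simp
  have "time (length_t D) \<le> length W + 1" "time (take_t q D) \<le> length W + 1"
    using D time_take_t[of q D] by (auto simp: time_basic)
  moreover have "time (search_t adj q W (C # Cs)) \<le> 1 + time (common_t adj C W) + time (length_t D)
      + (if q \<le> length D then time (take_t q D) else time (search_t adj q W Cs))"
    by (simp add: D_def del: val_common_t)
  ultimately have "time (search_t adj q W (C # Cs)) \<le> (q + 2) * (length W + 2)
      + (length Cs * ((q + 2) * (length W + 2)) + length W + 2)"
    using * Cons by (cases "q \<le> length D") (auto simp: algebra_simps)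
  then show ?case by simp
qed simp

text \<open>Only the enumeration of subsets could exceed polynomial time; the hypothesis on the
  binomial sum keeps it, and the number of candidates, linear up to a polynomial factor.\<close>

lemma time_find_bipartite:
  assumes "length vs = n" "q \<le> n" "(\<Sum>i\<le>q. r choose i) \<le> n"
  shows "time (find_bipartite adj vs q r) \<le> 20 * (n + 2) ^ 3"
proof -
  define N where "N = n + 2"
  define R where "R = val (highest_degree_t adj vs r)"
  define W where "W = filter (\<lambda>v. v \<notin> set R) vs"
  define Cs where "Cs = val (subsets_t q R)"
  \<comment> \<open>\<open>r\<close> is arbitrary here and may exceed \<open>n\<close>, in which
    case \<open>R\<close> has fewer than \<open>r\<close> entries.\<close>
  have R: "length R \<le> n" "length R \<le> r"
    using assms(1) by (auto simp: R_def highest_degree_t_def)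
  have W: "length W \<le> n"
    using assms(1) by (auto simp: W_def)
  have "(\<Sum>i\<le>q. length R choose i) \<le> (\<Sum>i\<le>q. r choose i)"
    using R by (intro sum_mono binomial_right_mono)
  then have S: "(\<Sum>i\<le>q. length R choose i) \<le> n"
    using assms(3) by linarith
  have "length R choose q \<le> (\<Sum>i\<le>q. length R choose i)"
    by (rule member_le_sum) auto
  then have Cs: "length Cs \<le> n"
    using S by (simp add: Cs_def length_subsets_t)
  have N2: "N \<le> N\<^sup>2" "N\<^sup>2 \<le> N ^ 3"
    by (auto simp: N_def power2_eq_square power3_eq_cube)
  have "time (degrees_t adj vs vs) \<le> N\<^sup>2"
    using assms(1) by (simp add: time_degrees_t N_def power2_eq_square)
  moreover have "time (sort_t (val (degrees_t adj vs vs))) \<le> N\<^sup>2"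
  proof -
    have "time (sort_t (val (degrees_t adj vs vs))) \<le> (n + 1)\<^sup>2"
      using time_sort_t[of "val (degrees_t adj vs vs)"] assms(1) by simp
    also have "\<dots> \<le> N\<^sup>2"
      by (intro power_mono) (auto simp: N_def)
    finally show ?thesis .
  qed
  moreover have "time (take_t r (val (sort_t (val (degrees_t adj vs vs))))) \<le> N"
    using time_take_t[of r "val (sort_t (val (degrees_t adj vs vs)))"] assms(1) by (simp add: N_def)
  moreover have "time (vertices_t (take r (val (sort_t (val (degrees_t adj vs vs)))))) \<le> N"
    using assms(1) by (simp add: N_def time_basic)
  moreover have "1 \<le> N"
    by (simp add: N_def)
  ultimately have high: "time (highest_degree_t adj vs r) \<le> 5 * N ^ 3"
    using N2 unfolding highest_degree_t_def val_time_simps val_take_t by linarith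
  have "time (remove_t R vs) \<le> n * (n + 2) + 1"
  proof -
    have "n * (length R + 2) \<le> n * (n + 2)"
      using R by (intro mult_left_mono) auto
    then show ?thesis
      using time_remove_t[of R vs] unfolding assms(1) by linarith
  qed
  also have "\<dots> \<le> N\<^sup>2"
    by (simp add: N_def power2_eq_square)
  finally have remove: "time (remove_t R vs) \<le> N ^ 3"
    using N2 by linarith
  have "5 * (length R + 1) * (\<Sum>i\<le>q. length R choose i) \<le> 5 * N * N"
    using R S by (intro mult_mono) (auto simp: N_def)
  then have subsets: "time (subsets_t q R) \<le> 5 * N ^ 3"
    using N2 time_subsets_t[of q R] by (simp add: power2_eq_square)
  have "length Cs * ((q + 2) * (length W + 2)) \<le> N * (N * N)"
    using Cs W assms(2) by (intro mult_mono) (auto simp: N_def)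
  moreover have "time (search_t adj q W Cs) \<le>
      length Cs * ((q + 2) * (length W + 2)) + length W + 2"
    by (rule time_search_t) (auto simp: Cs_def length_in_subsets_t)
  moreover have "length W + 2 \<le> N"
    using W by (simp add: N_def)
  ultimately have search: "time (search_t adj q W Cs) \<le> 2 * N ^ 3"
    using N2 unfolding power3_eq_cube by linarith
  \<comment> \<open>The parts contribute 1 and 5, 1, 5, 2 times \<open>N ^ 3\<close>, well within
    20.\<close>
  have "time (find_bipartite adj vs q r) = 1 + time (highest_degree_t adj vs r)
      + time (remove_t R vs) + time (subsets_t q R) + time (search_t adj q W Cs)"
    by (simp add: find_bipartite_def R_def W_def Cs_def)
  moreover have "1 \<le> N ^ 3"
    by (simp add: N_def)
  ultimately show ?thesis
    using high remove subsets search unfolding N_def[symmetric] by linarith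
qed

lemma time_find_bipartite_fb:
  assumes "2 \<le> n" "0 < m" "2 * m \<le> n\<^sup>2" "length vs = n"
  shows "time (find_bipartite adj vs (fb_q n m) (fb_r n m)) \<le> 20 * (n + 2) ^ 3"
proof (rule time_find_bipartite[OF assms(4)])
  define q S where "q = fb_q n m" and "S = (\<Sum>i\<le>q. fb_r n m choose i)"
  have "real (2 ^ q * S) \<le> real n"
    using sum_binomial_fb_le[OF assms(1-3)] by (simp add: q_def S_def)
  then have le: "2 ^ q * S \<le> n"
    by (simp only: of_nat_le_iff)
  \<comment> \<open>The empty subset gives \<open>S >= 1\<close>, so \<open>le\<close> bounds
    \<open>2 ^ q\<close>, and with it \<open>q\<close>, by \<open>n\<close>.\<close>
  have "fb_r n m choose 0 \<le> S"
    unfolding S_def by (rule member_le_sum) auto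
  then have "2 ^ q * 1 \<le> 2 ^ q * S" "1 * S \<le> 2 ^ q * S"
    by (intro mult_le_mono; simp)+
  then show "fb_q n m \<le> n" "(\<Sum>i\<le>fb_q n m. fb_r n m choose i) \<le> n"
    using le less_exp[of q] unfolding q_def[symmetric] S_def[symmetric] by linarith+
qed

theorem theorem1:
  shows
    "(\<exists>n0. \<forall>(V :: 'a set) E vs n m q r.
        simple_graph V E \<and> distinct vs \<and> set vs = V \<and>
        n = card V \<and> m = card E \<and> q = fb_q n m \<and> r = fb_r n m \<and>
        n \<ge> n0 \<and> real m \<ge> 3 * real n powr (3/2) \<longrightarrow>
          (\<exists>C D. val (find_bipartite (adjacent E) vs q r) = Some (C, D) \<and>
                 complete_bipartite_in V E q (set C) (set D)) \<and>
          (real m > 8 * real n powr (3/2) \<longrightarrow> q \<ge> 2))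
     \<and>
     (\<exists>p :: nat poly. \<forall>(V :: 'a set) E vs n m q r.
        simple_graph V E \<and> E \<noteq> {} \<and> distinct vs \<and> set vs = V \<and>
        n = card V \<and> m = card E \<and> q = fb_q n m \<and> r = fb_r n m \<longrightarrow>
          time (find_bipartite (adjacent E) vs q r) \<le> poly p n)"
proof (intro conjI)
  have "(\<exists>C D. val (find_bipartite (adjacent E) vs (fb_q n m) (fb_r n m)) = Some (C, D) \<and>
        complete_bipartite_in V E (fb_q n m) (set C) (set D)) \<and>
      (real m > 8 * real n powr (3/2) \<longrightarrow> fb_q n m \<ge> 2)"
    if G: "simple_graph V E" and vs: "distinct vs" "set vs = V"
      and n: "n = card V" "2 \<le> n" and m: "m = card E" "real m \<ge> 3 * real n powr (3/2)"
    for V :: "'a set" and E vs n m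
  proof -
    have mn: "2 * m \<le> n\<^sup>2"
      using twice_card_edges_le[OF G] n m by simp
    show ?thesis
      using find_bipartite_returns_biclique[OF G vs, of "fb_r n m" "fb_q n m"]
        fb_r_le[OF n(2) mn m(2)] fb_q_pos[OF n(2) mn m(2)] fb_edges_bound_violated[OF n(2) mn m(2)]
        fb_q_ge_2[OF n(2) mn] n(1) m(1)
      by auto
  qed
  then show "\<exists>n0. \<forall>(V :: 'a set) E vs n m q r.
        simple_graph V E \<and> distinct vs \<and> set vs = V \<and>
        n = card V \<and> m = card E \<and> q = fb_q n m \<and> r = fb_r n m \<and>
        n \<ge> n0 \<and> real m \<ge> 3 * real n powr (3/2) \<longrightarrow>
          (\<exists>C D. val (find_bipartite (adjacent E) vs q r) = Some (C, D) \<and>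
                 complete_bipartite_in V E q (set C) (set D)) \<and>
          (real m > 8 * real n powr (3/2) \<longrightarrow> q \<ge> 2)"
    \<comment> \<open>The threshold 2 suffices because the density hypothesis itself then forces
      \<open>n >= 36\<close>.\<close>
    by (intro exI[of _ 2]) blast
next
  have "time (find_bipartite (adjacent E) vs (fb_q n m) (fb_r n m)) \<le> poly (smult 20 ([:2, 1:] ^ 3)) n"
    if G: "simple_graph V E" "E \<noteq> {}" and vs: "distinct vs" "set vs = V"
      and n: "n = card V" and m: "m = card E"
    for V :: "'a set" and E vs n m
  proof -
    have finV: "finite V" and E: "E \<subseteq> Pow V"
      using G by (auto simp: simple_graph_def)
    then have "finite E"
      using finite_subset by auto
    then have "0 < m"
      using G(2) m by (simp add: card_gt_0_iff)
    \<comment> \<open>A single edge already provides two vertices, as the estimates for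
      \<open>fb_q\<close> require.\<close>
    obtain e where "e \<subseteq> V" "card e = 2"
      using G by (auto simp: simple_graph_def)
    then have "2 \<le> n"
      using card_mono[OF finV, of e] n by simp
    have "length vs = n"
      using vs n distinct_card by metis
    then have "time (find_bipartite (adjacent E) vs (fb_q n m) (fb_r n m)) \<le> 20 * (n + 2) ^ 3"
      using twice_card_edges_le[OF G(1)] n m \<open>0 < m\<close> \<open>2 \<le> n\<close>
      by (intro time_find_bipartite_fb) auto
    then show ?thesis
      by (simp add: add.commute)
  qed
  then show "\<exists>p :: nat poly. \<forall>(V :: 'a set) E vs n m q r.
        simple_graph V E \<and> E \<noteq> {} \<and> distinct vs \<and> set vs = V \<and>
        n = card V \<and> m = card E \<and> q = fb_q n m \<and> r = fb_r n m \<longrightarrow>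
          time (find_bipartite (adjacent E) vs q r) \<le> poly p n"
    by (intro exI[of _ "smult 20 ([:2, 1:] ^ 3)"]) blast
qed

end
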